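(* Let $n\ge 1$. Then (1) $\displaystyle\sum_{\pi\in B_n}(-1)^{\ell_B(\pi)}q^{\mathrm{sor}_B(\pi)}=\prod_{k=1}^n \left( 1-q[2k-1]_q \right)$; (2) $\displaystyle\sum_{\pi\in B_n}(-1)^{\mathrm{neg}(\pi)}q^{\mathrm{sor}_B(\pi)}=\prod_{k=1}^n \left( [2k-1]_q-q^{2k-1} \right)$; (3) $\displaystyle\sum_{\pi\in B_n}(-1)^{\mathrm{inv}(|\pi|)}q^{\mathrm{sor}_B(\pi)}=\prod_{k=1}^n \left( 1-q[2k-2]_q+q^{2k-1} \right)$.
   Context: For an integer $m\ge 0$, $[m]_q:=1+q+\cdots+q^{m-1}$ (so $[0]_q=0$). $B_n$ is the group of signed permutations: bijections $\pi$ of $\{\pm1,\dots,\pm n\}$ with $\pi(-i)=-\pi(i)$, written $\pi=\pi_1\cdots\pi_n$ with $\pi_i=\pi(i)$; multiplication is composition $(\pi\rho)(x)=\pi(\rho(x))$. We write $\bar i=-i$. Put $|\pi|:=|\pi_1|\cdots|\pi_n|\in\mathfrak S_n$, $\mathrm{Neg}(\pi):=\{i\in\{1,\dots,n\}:\pi_i<0\}$, $\mathrm{neg}(\pi):=|\mathrm{Neg}(\pi)|$. With respect to the usual order of the integers, $\mathrm{inv}(\pi):=|\{(i,j):1\le i<j\le n,\ \pi_i>\pi_j\}|$. $\ell_B$ is the Coxeter length function of $B_n$ with respect to the generators $s_0=(1,-1)$ and $s_i=(i,i+1)$, $1\le i\le n-1$; it satisfies $\ell_B(\pi)=\mathrm{inv}(\pi)-\sum_{i\in\mathrm{Neg}(\pi)}\pi_i$.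 Type $B$ sorting index: write $i^{[0]}=i$, $i^{[1]}=\bar i=-i$. For $1\le i<j\le n$ and $t\in\{0,1\}$ let $(i^{[t]},j)\in B_n$ be the signed permutation exchanging $i^{[t]}$ with $j$ and $-i^{[t]}$ with $-j$ and fixing everything else; for $1\le i\le n$ let $(i^{[1]},i)$ be the signed permutation exchanging $i$ and $-i$. Every $\pi\in B_n$ has a unique expression $\pi=(i_1^{[t_1]},j_1)\cdots(i_m^{[t_m]},j_m)$ as a product of such elements with $0<j_1<\cdots<j_m$, $m\ge0$. Then $$\mathrm{sor}_B(\pi):=\sum_{s=1}^m\Big(j_s-i_s+\delta(t_s>0)\cdot\big(2(i_s-1)+t_s\big)\Big),$$ where $\delta(\mathsf A)=1$ if $\mathsf A$ is true and $0$ otherwise. *)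

theory Defs
  imports "HOL-Combinatorics.Permutations"
begin

definition q_bracket :: "nat \<Rightarrow> 'a::comm_ring_1 \<Rightarrow> 'a" where
  "q_bracket m q = (\<Sum>i<m. q ^ i)"

(* Signed permutations are extended to all integers by the identity, as for "permutes". *)
definition signed_perms :: "nat \<Rightarrow> (int \<Rightarrow> int) set" where
  "signed_perms n = {\<pi>. \<pi> permutes ({- int n..int n} - {0}) \<and> (\<forall>x. \<pi> (- x) = - \<pi> x)}"

definition Neg :: "nat \<Rightarrow> (int \<Rightarrow> int) \<Rightarrow> nat set" where
  "Neg n \<pi> = {i \<in> {1..n}. \<pi> (int i) < 0}"

definition neg :: "nat \<Rightarrow> (int \<Rightarrow> int) \<Rightarrow> nat" where
  "neg n \<pi> = card (Neg n \<pi>)"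

definition abs_perm :: "(int \<Rightarrow> int) \<Rightarrow> nat \<Rightarrow> nat" where
  "abs_perm \<pi> i = nat \<bar>\<pi> (int i)\<bar>"

definition inversions :: "nat \<Rightarrow> (nat \<Rightarrow> 'a::linorder) \<Rightarrow> nat" where
  "inversions n w = card {(i, j). 1 \<le> i \<and> i < j \<and> j \<le> n \<and> w i > w j}"

(* Exchanges a with b and -a with -b, for a, b nonzero; b = -a is allowed, giving the
   transposition of a and -a. *)
definition signed_swap :: "int \<Rightarrow> int \<Rightarrow> int \<Rightarrow> int" where
  "signed_swap a b x =
     (if x = a then b else if x = b then a
      else if x = - a then - b else if x = - b then - a else x)"

definition generators_B :: "nat \<Rightarrow> (int \<Rightarrow> int) set" where
  "generators_B n =
     insert (signed_swap 1 (- 1)) {signed_swap (int i) (int i + 1) | i. 1 \<le> i \<and> i < n}"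

definition length_B :: "nat \<Rightarrow> (int \<Rightarrow> int) \<Rightarrow> nat" where
  "length_B n \<pi> =
     (LEAST k. \<exists>ws. length ws = k \<and> set ws \<subseteq> generators_B n \<and> foldr (\<circ>) ws id = \<pi>)"

(* A triple (i, t, j) encodes the factor (i^[t], j), where i^[t] = (-1)^t i. *)
definition factor_B :: "nat \<times> nat \<times> nat \<Rightarrow> int \<Rightarrow> int" where
  "factor_B = (\<lambda>(i, t, j). signed_swap ((- 1) ^ t * int i) (int j))"

definition sorting_factorization :: "nat \<Rightarrow> (int \<Rightarrow> int) \<Rightarrow> (nat \<times> nat \<times> nat) list \<Rightarrow> bool" where
  "sorting_factorization n \<pi> fs \<longleftrightarrow>
     (\<forall>(i, t, j) \<in> set fs. 1 \<le> i \<and> j \<le> n \<and> (i < j \<and> t \<in> {0, 1} \<or> i = j \<and> t = 1)) \<and>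
     sorted_wrt (<) (map (\<lambda>(i, t, j). j) fs) \<and>
     \<pi> = foldr (\<circ>) (map factor_B fs) id"

(* Every element of signed_perms n has exactly one sorting factorization; since 1 \<le> i \<le> j
   in its factors, the subtractions below do not truncate. *)
definition sor_B :: "nat \<Rightarrow> (int \<Rightarrow> int) \<Rightarrow> nat" where
  "sor_B n \<pi> =
     (\<Sum>(i, t, j) \<leftarrow> (THE fs. sorting_factorization n \<pi> fs).
        j - i + (if t > 0 then 2 * (i - 1) + t else 0))"

end

theory Submission imports Defs
begin

text \<open>
  All three signs are instances of one phenomenon. Let \<open>\<chi>\<close> be a function on $B_N$ that is
  multiplicative, takes the value $d$ on the generator $s_0$ and the value $c$ on each $s_i$ with
  $i \<ge> 1$, where $c^2 = d^2 = 1$. Then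
  \[ \sum_{\pi \in B_n} \chi(\pi) q^{sor_B(\pi)}
     = \prod_{k=1}^{n} (1 + c q [2k-2]_q + d q^{2k-1}) \quad (n \le N), \]
  which is \<open>signed_character.char_sum\<close>. The reason is the coset decomposition
  \<open>signed_perms_Suc_bij\<close>: every element of $B_m$ is uniquely $\rho$ composed with the reflection
  exchanging $a$ and $m$, where $\rho \in B_{m-1}$ and $a$ is one of the $2m$ letters
  (the letter $a = m$ giving the identity). Iterating it produces the sorting factorization, so
  the sorting index is additive along it, the contribution of $a$ being a weight
  (\<open>sor_B_Suc\<close>). These weights run exactly once through $0, \dots, 2m-1$: the weight 0 belongs to
  the identity, $2m-1$ to the short reflection $a = -m$, and everything in between to long
  reflections. Short reflections are conjugate to $s_0$ and long ones to the other $s_i$, so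
  \<open>\<chi>\<close> equals 1, $d$ and $c$ on them respectively, and the factor for $m$ appears.

  The parity of \<open>neg\<close> is such a character with $(c, d) = (1, -1)$ and the parity of
  \<open>inversions\<close> of the absolute value is one with $(c, d) = (-1, 1)$. Their product takes the value
  $-1$ on all generators and hence equals $(-1)^k$ on every word of length $k$; since the generators
  generate the group, it is the parity of the length (\<open>length_B_parity\<close>), with
  $(c, d) = (-1, -1)$.
\<close>

section \<open>Signed permutations and reflections\<close>

abbreviation letters :: "nat \<Rightarrow> int set" where
  "letters n \<equiv> {- int n..int n} - {0}"

lemma signed_perms_permutes: "\<pi> \<in> signed_perms n \<Longrightarrow> \<pi> permutes letters n"
  and signed_perms_odd: "\<pi> \<in> signed_perms n \<Longrightarrow> \<pi> (- x) = - \<pi> x"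
  by (auto simp: signed_perms_def)

lemma signed_perms_comp:
  "\<pi> \<in> signed_perms n \<Longrightarrow> \<rho> \<in> signed_perms n \<Longrightarrow> \<pi> \<circ> \<rho> \<in> signed_perms n"
  by (auto simp: signed_perms_def intro: permutes_compose)

lemma id_in_signed_perms: "id \<in> signed_perms n"
  by (auto simp: signed_perms_def permutes_id)

lemma signed_perms_mono: "m \<le> n \<Longrightarrow> signed_perms m \<subseteq> signed_perms n"
  by (auto simp: signed_perms_def elim!: permutes_subset)

lemma signed_swap_invol: "a \<noteq> 0 \<Longrightarrow> b \<noteq> 0 \<Longrightarrow> signed_swap a b (signed_swap a b x) = x"
  by (auto simp: signed_swap_def)

lemma signed_swap_comp_self:
  "a \<noteq> 0 \<Longrightarrow> b \<noteq> 0 \<Longrightarrow> signed_swap a b \<circ> signed_swap a b = id"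
  by (auto simp: signed_swap_invol)

lemma signed_swap_self: "signed_swap a a = id"
  by (auto simp: signed_swap_def)

lemma signed_swap_in_signed_perms:
  assumes "a \<in> letters n" "b \<in> letters n"
  shows "signed_swap a b \<in> signed_perms n"
proof -
  have "bij (signed_swap a b)"
    using assms by (intro involuntory_imp_bij) (auto simp: signed_swap_invol)
  moreover have "signed_swap a b x = x" if "x \<notin> letters n" for x
    using assms that by (auto simp: signed_swap_def)
  ultimately have "signed_swap a b permutes letters n"
    by (simp add: permutes_def bij_iff)
  moreover have "signed_swap a b (- x) = - signed_swap a b x" for x
    using assms by (auto simp: signed_swap_def)
  ultimately show ?thesis by (simp add: signed_perms_def)
qed

text \<open>
  Conjugating a reflection by an involution that commutes with negation relabels it. All conjugacy
  arguments below rest on this.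
\<close>
lemma signed_swap_conj:
  assumes "\<And>x. f (- x) = - f x" "\<And>x. f (f x) = x"
  shows "f \<circ> signed_swap a b \<circ> f = signed_swap (f a) (f b)"
proof
  fix x
  have eq: "f x = y \<longleftrightarrow> x = f y" for y using assms(2) by metis
  show "(f \<circ> signed_swap a b \<circ> f) x = signed_swap (f a) (f b) x"
    by (simp add: signed_swap_def eq assms)
qed

lemma generators_B_cases:
  assumes "g \<in> generators_B n"
  obtains "g = signed_swap 1 (- 1)" | i where "1 \<le> i" "i < n" "g = signed_swap (int i) (int i + 1)"
  using assms by (auto simp: generators_B_def)

lemma simple_in_generators_B:
  "signed_swap 1 (- 1) \<in> generators_B n"
  "1 \<le> i \<Longrightarrow> i < n \<Longrightarrow> signed_swap (int i) (int i + 1) \<in> generators_B n"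
  by (auto simp: generators_B_def)

lemma generators_B_subset: "n \<ge> 1 \<Longrightarrow> generators_B n \<subseteq> signed_perms n"
  by (auto elim!: generators_B_cases intro!: signed_swap_in_signed_perms)

lemma generators_B_conj:
  assumes "g \<in> generators_B n"
  shows "g \<circ> signed_swap a b \<circ> g = signed_swap (g a) (g b)"
  using assms
  by (elim generators_B_cases) (auto intro!: signed_swap_conj, auto simp: signed_swap_def)

text \<open>
  The reflections form two conjugacy classes: walking up along $s_1, s_2, \dots$ carries the short
  one at 1 to all short ones. Stated as an induction principle, this serves both to evaluate
  characters and to show that the generators generate.
\<close>
lemma short_reflection_induct:
  assumes "1 \<le> m" "m \<le> n"
    and base: "P (signed_swap 1 (- 1))"
    and conj: "\<And>g r. g \<in> generators_B n \<Longrightarrow> P r \<Longrightarrow> P (g \<circ> r \<circ> g)"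
  shows "P (signed_swap (- int m) (int m))"
  using assms(1,2)
proof (induction m rule: nat_induct_at_least)
  case base
  have "signed_swap (- 1) 1 = signed_swap 1 (- 1)" by (auto simp: signed_swap_def)
  then show ?case using assms(3) by simp
next
  case (Suc m)
  let ?g = "signed_swap (int m) (int m + 1)"
  have g: "?g \<in> generators_B n" using Suc by (intro simple_in_generators_B) auto
  have "?g (- int m) = - int (Suc m)" "?g (int m) = int (Suc m)"
    using Suc.hyps by (auto simp: signed_swap_def)
  with conj[OF g, of "signed_swap (- int m) (int m)"] Suc generators_B_conj[OF g]
  show ?case by simp
qed

text \<open>
  The same for long reflections. For positive $a$ the larger letter is raised by $s_m$, starting from
  adjacent letters. The sign of $a$ is changed at $a = 1$ by $s_0$, and then $-1$ is lowered to $a$ by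
  $s_1, s_2, \dots$, none of which moves the larger letter.
\<close>
lemma long_reflection_induct:
  assumes a: "a \<noteq> 0" "\<bar>a\<bar> < int m" "m \<le> n"
    and base: "\<And>i. 1 \<le> i \<Longrightarrow> i < n \<Longrightarrow> P (signed_swap (int i) (int i + 1))"
    and conj: "\<And>g r. g \<in> generators_B n \<Longrightarrow> P r \<Longrightarrow> P (g \<circ> r \<circ> g)"
  shows "P (signed_swap a (int m))"
proof -
  have pos: "P (signed_swap (int i) (int m))" if "1 \<le> i" "Suc i \<le> m" "m \<le> n" for i m
    using that(2,1,3)
  proof (induction m rule: nat_induct_at_least)
    case base
    then show ?case using assms(4)[of i] by (simp add: add.commute)
  next
    case (Suc m)
    let ?g = "signed_swap (int m) (int m + 1)"
    have g: "?g \<in> generators_B n" using Suc by (intro simple_in_generators_B) auto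
    have "?g (int i) = int i" "?g (int m) = int (Suc m)"
      using Suc.hyps Suc.prems by (auto simp: signed_swap_def)
    with conj[OF g, of "signed_swap (int i) (int m)"] Suc generators_B_conj[OF g]
    show ?case by simp
  qed
  have neg: "P (signed_swap (- int i) (int m))" if "1 \<le> i" "i < m" for i
    using that
  proof (induction i rule: nat_induct_at_least)
    case base
    let ?g = "signed_swap 1 (- 1)"
    have g: "?g \<in> generators_B n" by (rule simple_in_generators_B)
    have "?g (int 1) = - 1" "?g (int m) = int m"
      using base by (auto simp: signed_swap_def)
    with conj[OF g pos[of 1 m]] base generators_B_conj[OF g] assms(3)
    show ?case by simp
  next
    case (Suc i)
    let ?g = "signed_swap (int i) (int i + 1)"
    have g: "?g \<in> generators_B n" using Suc assms(3) by (intro simple_in_generators_B) auto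
    have "?g (- int i) = - int (Suc i)" "?g (int m) = int m"
      using Suc.hyps Suc.prems by (auto simp: signed_swap_def)
    with conj[OF g, of "signed_swap (- int i) (int m)"] Suc generators_B_conj[OF g]
    show ?case by simp
  qed
  show ?thesis
    using pos[of "nat \<bar>a\<bar>" m] neg[of "nat \<bar>a\<bar>"] a by (cases "a > 0") auto
qed

section \<open>The coset decomposition and the sorting index\<close>

lemma signed_perms_0: "signed_perms 0 = {id}"
  by (auto simp: signed_perms_def)

lemma signed_perms_fixes: "\<pi> \<in> signed_perms n \<Longrightarrow> \<pi> (int (Suc n)) = int (Suc n)"
  by (rule permutes_not_in[OF signed_perms_permutes]) auto

text \<open>
  The letter $a$ is recovered from the product as the preimage of the top letter, which is
  fixed by $B_n$; composing once more with the reflection then recovers \<open>\<pi>\<close>. For surjectivity, note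
  that an odd map fixing the top letter also fixes its negative, so it lies in $B_n$.
\<close>
lemma signed_perms_Suc_bij:
  "bij_betw (\<lambda>(\<pi>, a). \<pi> \<circ> signed_swap a (int (Suc n)))
     (signed_perms n \<times> letters (Suc n)) (signed_perms (Suc n))"
  (is "bij_betw ?F ?A ?B")
proof (rule bij_betwI')
  fix x y assume x: "x \<in> ?A" and y: "y \<in> ?A"
  obtain p a where xe: "x = (p, a)" by (cases x)
  obtain r b where ye: "y = (r, b)" by (cases y)
  have p: "p \<in> signed_perms n" "a \<in> letters (Suc n)"
    and r: "r \<in> signed_perms n" "b \<in> letters (Suc n)"
    using x y xe ye by auto
  have sw: "signed_swap c (int (Suc n)) c = int (Suc n)" for c by (simp add: signed_swap_def)
  show "?F x = ?F y \<longleftrightarrow> x = y"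
  proof
    assume "?F x = ?F y"
    then have eq: "p \<circ> signed_swap a (int (Suc n)) = r \<circ> signed_swap b (int (Suc n))"
      by (simp add: xe ye)
    have "(p \<circ> signed_swap a (int (Suc n))) a = int (Suc n)"
      using signed_perms_fixes[OF p(1)] by (simp only: comp_apply sw)
    moreover have "(p \<circ> signed_swap a (int (Suc n))) b = int (Suc n)"
      unfolding eq using signed_perms_fixes[OF r(1)] by (simp only: comp_apply sw)
    moreover have "p \<circ> signed_swap a (int (Suc n)) \<in> signed_perms (Suc n)"
      using p signed_perms_mono[of n "Suc n"]
      by (intro signed_perms_comp signed_swap_in_signed_perms) auto
    ultimately have ab: "a = b"
      by (metis permutes_inj signed_perms_permutes injD)
    have "p \<circ> (signed_swap a (int (Suc n)) \<circ> signed_swap a (int (Suc n)))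
        = r \<circ> (signed_swap a (int (Suc n)) \<circ> signed_swap a (int (Suc n)))"
      using eq ab by (simp add: comp_assoc[symmetric])
    then have "p = r"
      using p by (simp add: signed_swap_comp_self)
    then show "x = y" using ab xe ye by simp
  qed simp
next
  fix x assume "x \<in> ?A"
  then show "?F x \<in> ?B"
    using signed_perms_mono[of n "Suc n"]
    by (cases x) (auto intro!: signed_perms_comp signed_swap_in_signed_perms)
next
  fix p assume p: "p \<in> ?B"
  have per: "p permutes letters (Suc n)" by (rule signed_perms_permutes[OF p])
  have "int (Suc n) \<in> p ` letters (Suc n)"
    unfolding permutes_image[OF per] by auto
  then obtain a where a: "a \<in> letters (Suc n)" "p a = int (Suc n)" by (elim imageE) metis
  define r where "r = p \<circ> signed_swap a (int (Suc n))"
  have rS: "r \<in> signed_perms (Suc n)"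
    unfolding r_def using a by (intro signed_perms_comp p signed_swap_in_signed_perms) auto
  have fix1: "r (int (Suc n)) = int (Suc n)"
    using a by (auto simp: r_def signed_swap_def)
  have "r x = x" if "x \<in> letters (Suc n) - letters n" for x
  proof -
    have "x = int (Suc n) \<or> x = - int (Suc n)" using that by auto
    then show ?thesis using fix1 signed_perms_odd[OF rS, of "int (Suc n)"] by auto
  qed
  then have "r permutes letters n"
    by (rule permutes_superset[OF signed_perms_permutes[OF rS]])
  then have rn: "r \<in> signed_perms n" using rS by (simp add: signed_perms_def)
  have "p = r \<circ> signed_swap a (int (Suc n))"
    using a by (simp add: r_def comp_assoc signed_swap_comp_self)
  then show "\<exists>x\<in>?A. p = ?F x"
    using rn a by (intro bexI[of _ "(r, a)"]) auto
qed

lemma signed_perms_Suc_cases: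
  assumes "\<pi> \<in> signed_perms (Suc n)"
  obtains \<rho> a where "\<rho> \<in> signed_perms n" "a \<in> letters (Suc n)"
    "\<pi> = \<rho> \<circ> signed_swap a (int (Suc n))"
proof -
  from assms have "\<pi> \<in> (\<lambda>(\<rho>, a). \<rho> \<circ> signed_swap a (int (Suc n)))
      ` (signed_perms n \<times> letters (Suc n))"
    unfolding bij_betw_imp_surj_on[OF signed_perms_Suc_bij] .
  then show thesis by (elim imageE SigmaE) (use that in simp)
qed

text \<open>
  The part of a sorting factorization with largest letter $m$: at most one factor. The letter $m$
  itself stands for its absence, matching the fact that swapping $m$ with $m$ is the identity.
\<close>
definition factor_list :: "nat \<Rightarrow> int \<Rightarrow> (nat \<times> nat \<times> nat) list" where
  "factor_list m a = (if a = int m then [] else [(nat \<bar>a\<bar>, if a < 0 then 1 else 0, m)])"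

text \<open>
  The contribution of a factor to the sorting index, rewritten in terms of the signed letter. For
  $a = -i$ with $i < m$ it is $m - i + 2(i - 1) + 1 = m + i - 1$, and the same formula gives $2m - 1$
  for $i = m$. Counted from the top letter downwards, this is the position of $a$ among the
  nonzero letters.
\<close>
definition swap_weight :: "nat \<Rightarrow> int \<Rightarrow> nat" where
  "swap_weight m a = nat (if a > 0 then int m - a else int m - a - 1)"

lemma foldr_comp_append: "foldr (\<circ>) (xs @ ys) id = foldr (\<circ>) xs id \<circ> foldr (\<circ>) ys id"
  by (induction xs) (auto simp: comp_assoc)

lemma foldr_factor_list:
  "foldr (\<circ>) (map factor_B (factor_list m a)) id = signed_swap a (int m)"
  by (auto simp: factor_list_def factor_B_def signed_swap_self)

lemma sorting_factorization_0: "sorting_factorization 0 \<pi> fs \<longleftrightarrow> fs = [] \<and> \<pi> = id"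
  by (cases fs) (auto simp: sorting_factorization_def)

text \<open>
  Since the larger letters of the factors increase strictly, only the last factor can involve the
  top letter. This makes existence and uniqueness of the factorization the iterated
  form of \<open>signed_perms_Suc_bij\<close>.
\<close>
lemma sorting_factorization_Suc:
  "sorting_factorization (Suc n) \<pi> gs \<longleftrightarrow>
     (\<exists>\<rho> a fs. a \<in> letters (Suc n) \<and> sorting_factorization n \<rho> fs \<and>
        gs = fs @ factor_list (Suc n) a \<and> \<pi> = \<rho> \<circ> signed_swap a (int (Suc n)))"
  (is "?L \<longleftrightarrow> ?R")
proof
  assume L: ?L
  show ?R
  proof (cases "\<exists>i t. (i, t, Suc n) \<in> set gs")
    case False
    then have "sorting_factorization n \<pi> gs"
      using L unfolding sorting_factorization_def by (auto simp: le_Suc_eq)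
    then show ?thesis
      by (intro exI[of _ \<pi>] exI[of _ "int (Suc n)"] exI[of _ gs])
         (auto simp: factor_list_def signed_swap_self)
  next
    case True
    then obtain i t xs ys where gs: "gs = xs @ (i, t, Suc n) # ys"
      by (meson split_list)
    have "ys = []"
      using L unfolding sorting_factorization_def gs
      by (cases ys) (auto simp: sorted_wrt_append)
    with gs have gs: "gs = xs @ [(i, t, Suc n)]" by simp
    define a where "a = (- 1) ^ t * int i"
    have it: "1 \<le> i" "i < Suc n \<and> t \<in> {0, 1} \<or> i = Suc n \<and> t = 1"
      using L unfolding sorting_factorization_def gs by auto
    have a: "a \<in> letters (Suc n)" "factor_list (Suc n) a = [(i, t, Suc n)]"
      using it by (auto simp: a_def factor_list_def)
    have "sorting_factorization n (foldr (\<circ>) (map factor_B xs) id) xs"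
      using L unfolding sorting_factorization_def gs
      by (fastforce simp: sorted_wrt_append)
    moreover have "\<pi> = foldr (\<circ>) (map factor_B xs) id \<circ> signed_swap a (int (Suc n))"
      using L unfolding sorting_factorization_def gs
      by (simp only: map_append foldr_comp_append a(2)[symmetric] foldr_factor_list)
    ultimately show ?thesis using a gs by metis
  qed
next
  assume ?R
  then obtain \<rho> a fs where a: "a \<in> letters (Suc n)"
    and fs: "sorting_factorization n \<rho> fs"
    and gs: "gs = fs @ factor_list (Suc n) a"
    and pi: "\<pi> = \<rho> \<circ> signed_swap a (int (Suc n))" by blast
  have 1: "\<forall>(i, t, j) \<in> set gs. 1 \<le> i \<and> j \<le> Suc n \<and> (i < j \<and> t \<in> {0, 1} \<or> i = j \<and> t = 1)"
  proof -
    have "\<forall>(i, t, j) \<in> set fs. 1 \<le> i \<and> j \<le> Suc n \<and> (i < j \<and> t \<in> {0, 1} \<or> i = j \<and> t = 1)"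
      using fs unfolding sorting_factorization_def by auto
    moreover have "\<forall>(i, t, j) \<in> set (factor_list (Suc n) a).
        1 \<le> i \<and> j \<le> Suc n \<and> (i < j \<and> t \<in> {0, 1} \<or> i = j \<and> t = 1)"
      using a by (auto simp: factor_list_def)
    ultimately show ?thesis unfolding gs set_append ball_Un ..
  qed
  have 2: "sorted_wrt (<) (map (\<lambda>(i, t, j). j) gs)"
  proof -
    have "j < Suc n" if "(i, t, j) \<in> set fs" for i t j
      using fs that unfolding sorting_factorization_def by auto
    then show ?thesis
      using fs unfolding sorting_factorization_def gs
      by (auto simp: factor_list_def sorted_wrt_append)
  qed
  have 3: "\<pi> = foldr (\<circ>) (map factor_B gs) id"
    using fs unfolding sorting_factorization_def gs pi
    by (simp only: map_append foldr_comp_append foldr_factor_list)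
  show ?L using 1 2 3 unfolding sorting_factorization_def by blast
qed

lemma sorting_factorization_in_signed_perms:
  "sorting_factorization n \<pi> fs \<Longrightarrow> \<pi> \<in> signed_perms n"
proof (induction n arbitrary: \<pi> fs)
  case 0
  then show ?case unfolding sorting_factorization_0 signed_perms_0 by blast
next
  case (Suc n)
  then obtain \<rho> a gs where "a \<in> letters (Suc n)" "sorting_factorization n \<rho> gs"
    "\<pi> = \<rho> \<circ> signed_swap a (int (Suc n))"
    unfolding sorting_factorization_Suc by blast
  then show ?case
    using Suc.IH[of \<rho> gs] bij_betw_apply[OF signed_perms_Suc_bij, of "(\<rho>, a)" n]
    by (simp only: mem_Sigma_iff prod.case)
qed

lemma sorting_factorization_unique:
  assumes "sorting_factorization n \<pi> fs" "sorting_factorization n \<pi> gs"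
  shows "fs = gs"
  using assms
proof (induction n arbitrary: \<pi> fs gs)
  case 0
  then show ?case by (simp add: sorting_factorization_0)
next
  case (Suc n)
  obtain \<rho> a fs' where 1: "a \<in> letters (Suc n)" "sorting_factorization n \<rho> fs'"
      "fs = fs' @ factor_list (Suc n) a" "\<pi> = \<rho> \<circ> signed_swap a (int (Suc n))"
    using Suc.prems(1) unfolding sorting_factorization_Suc by blast
  obtain \<sigma> b gs' where 2: "b \<in> letters (Suc n)" "sorting_factorization n \<sigma> gs'"
      "gs = gs' @ factor_list (Suc n) b" "\<pi> = \<sigma> \<circ> signed_swap b (int (Suc n))"
    using Suc.prems(2) unfolding sorting_factorization_Suc by blast
  have "(\<rho>, a) = (\<sigma>, b)"
    using inj_onD[OF bij_betw_imp_inj_on[OF signed_perms_Suc_bij[of n]], of "(\<rho>, a)" "(\<sigma>, b)"]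
      1 2 sorting_factorization_in_signed_perms by auto
  with Suc.IH[of \<rho> fs' gs'] 1 2 show ?case by simp
qed

lemma sorting_factorization_exists:
  "\<pi> \<in> signed_perms n \<Longrightarrow> \<exists>fs. sorting_factorization n \<pi> fs"
proof (induction n arbitrary: \<pi>)
  case 0
  then show ?case unfolding sorting_factorization_0 signed_perms_0 by blast
next
  case (Suc n)
  from Suc.prems obtain \<rho> a where "\<rho> \<in> signed_perms n" and a: "a \<in> letters (Suc n)"
    "\<pi> = \<rho> \<circ> signed_swap a (int (Suc n))"
    by (rule signed_perms_Suc_cases)
  moreover from this Suc.IH obtain fs where "sorting_factorization n \<rho> fs" by blast
  ultimately have "sorting_factorization (Suc n) \<pi> (fs @ factor_list (Suc n) a)"
    unfolding sorting_factorization_Suc by blast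
  then show ?case ..
qed

lemma sor_B_eq:
  assumes "sorting_factorization n \<pi> fs"
  shows "sor_B n \<pi> = (\<Sum>(i, t, j) \<leftarrow> fs. j - i + (if t > 0 then 2 * (i - 1) + t else 0))"
proof -
  have "(THE fs. sorting_factorization n \<pi> fs) = fs"
    using assms sorting_factorization_unique by blast
  then show ?thesis by (simp add: sor_B_def)
qed

lemma sor_B_0: "sor_B 0 id = 0"
  using sor_B_eq[of 0 id "[]"] by (simp add: sorting_factorization_0)

lemma sor_B_Suc:
  assumes "\<rho> \<in> signed_perms n" "a \<in> letters (Suc n)"
  shows "sor_B (Suc n) (\<rho> \<circ> signed_swap a (int (Suc n))) = sor_B n \<rho> + swap_weight (Suc n) a"
proof -
  obtain fs where fs: "sorting_factorization n \<rho> fs"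
    using sorting_factorization_exists[OF assms(1)] by blast
  then have "sorting_factorization (Suc n) (\<rho> \<circ> signed_swap a (int (Suc n)))
               (fs @ factor_list (Suc n) a)"
    using assms(2) unfolding sorting_factorization_Suc by blast
  from sor_B_eq[OF this] sor_B_eq[OF fs] show ?thesis
    using assms(2) by (auto simp: factor_list_def swap_weight_def nat_diff_distrib)
qed

section \<open>Sums twisted by a linear character\<close>

locale signed_character =
  fixes N :: nat and \<chi> :: "(int \<Rightarrow> int) \<Rightarrow> 'a::comm_ring_1" and c d :: 'a
  assumes N: "N \<ge> 1"
    and mult: "\<pi> \<in> signed_perms N \<Longrightarrow> \<rho> \<in> signed_perms N \<Longrightarrow> \<chi> (\<pi> \<circ> \<rho>) = \<chi> \<pi> * \<chi> \<rho>"
    and simple_0: "\<chi> (signed_swap 1 (- 1)) = d"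
    and simple_i: "1 \<le> i \<Longrightarrow> i < N \<Longrightarrow> \<chi> (signed_swap (int i) (int i + 1)) = c"
    and cc: "c * c = 1" and dd: "d * d = 1"
begin

lemma char_id: "\<chi> id = 1"
proof -
  have "signed_swap 1 (- 1) \<in> signed_perms N"
    using N by (intro signed_swap_in_signed_perms) auto
  from mult[OF this this] show ?thesis
    by (simp add: signed_swap_comp_self simple_0 dd)
qed

text \<open>
  The values of \<open>\<chi>\<close> on generators square to 1 and commute with everything, hence cancel in a
  conjugate by a generator.
\<close>
lemma char_conj:
  assumes "g \<in> generators_B N" "r \<in> signed_perms N \<and> \<chi> r = e"
  shows "g \<circ> r \<circ> g \<in> signed_perms N \<and> \<chi> (g \<circ> r \<circ> g) = e"
proof -
  have g: "g \<in> signed_perms N" using generators_B_subset[OF N] assms by auto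
  have "\<chi> g * \<chi> g = 1"
    using assms(1) by (elim generators_B_cases) (auto simp: simple_0 simple_i cc dd)
  then have "\<chi> g * e * \<chi> g = e" by (metis mult.assoc mult.commute mult.right_neutral)
  then show ?thesis
    using assms g by (simp add: mult signed_perms_comp)
qed

lemma char_short:
  assumes "1 \<le> m" "m \<le> N"
  shows "\<chi> (signed_swap (- int m) (int m)) = d"
proof -
  have "signed_swap 1 (- 1) \<in> signed_perms N \<and> \<chi> (signed_swap 1 (- 1)) = d"
    using simple_in_generators_B(1) generators_B_subset[OF N] simple_0 by blast
  then have "signed_swap (- int m) (int m) \<in> signed_perms N \<and>
      \<chi> (signed_swap (- int m) (int m)) = d"
    by (rule short_reflection_induct[OF assms, where P = "\<lambda>r. r \<in> signed_perms N \<and> \<chi> r = d"])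
       (rule char_conj)
  then show ?thesis ..
qed

lemma char_long:
  assumes "a \<noteq> 0" "\<bar>a\<bar> < int m" "m \<le> N"
  shows "\<chi> (signed_swap a (int m)) = c"
proof -
  have "signed_swap (int i) (int i + 1) \<in> signed_perms N \<and> \<chi> (signed_swap (int i) (int i + 1)) = c"
    if "1 \<le> i" "i < N" for i
    using simple_in_generators_B(2)[OF that] generators_B_subset[OF N] simple_i[OF that] by blast
  then have "signed_swap a (int m) \<in> signed_perms N \<and> \<chi> (signed_swap a (int m)) = c"
    by (rule long_reflection_induct[OF assms, where P = "\<lambda>r. r \<in> signed_perms N \<and> \<chi> r = c"])
       (assumption | rule char_conj)+
  then show ?thesis ..
qed

text \<open>
  Reindexing by the weight turns the sum over letters into a sum over $0, \dots, 2n+1$, of which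
  the two ends are the identity and the short reflection.
\<close>
lemma char_coset_sum:
  assumes "Suc n \<le> N"
  shows "(\<Sum>a\<in>letters (Suc n). \<chi> (signed_swap a (int (Suc n))) * q ^ swap_weight (Suc n) a)
           = 1 + c * q * q_bracket (2 * n) q + d * q ^ (2 * n + 1)"
proof -
  define e where "e k = (if k = 0 then 1 else if k = 2 * n + 1 then d else c)" for k :: nat
  have val: "\<chi> (signed_swap a (int (Suc n))) = e (swap_weight (Suc n) a)"
    if "a \<in> letters (Suc n)" for a
  proof -
    consider "a = int (Suc n)" | "a = - int (Suc n)" | "\<bar>a\<bar> < int (Suc n)"
      using \<open>a \<in> letters (Suc n)\<close> by force
    then show ?thesis
    proof cases
      case 1
      then show ?thesis by (simp only: signed_swap_self char_id) (simp add: e_def swap_weight_def)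
    next
      case 2
      then show ?thesis using assms
        by (simp only: char_short) (simp add: e_def swap_weight_def nat_eq_iff)
    next
      case 3
      then have "\<chi> (signed_swap a (int (Suc n))) = c"
        using that assms by (intro char_long) auto
      then show ?thesis using that 3 by (auto simp: e_def swap_weight_def nat_eq_iff)
    qed
  qed
  have "(\<Sum>a\<in>letters (Suc n). \<chi> (signed_swap a (int (Suc n))) * q ^ swap_weight (Suc n) a)
      = (\<Sum>a\<in>letters (Suc n). e (swap_weight (Suc n) a) * q ^ swap_weight (Suc n) a)"
    by (intro sum.cong refl) (simp only: val)
  also have "\<dots> = (\<Sum>k<Suc (Suc (2 * n)). e k * q ^ k)"
    by (rule sum.reindex_bij_witness[of _
          "\<lambda>k. if k < Suc n then int (Suc n) - int k else int n - int k" "swap_weight (Suc n)"])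
       (auto simp: swap_weight_def split: if_splits)
  also have "\<dots> = 1 + (\<Sum>k<2 * n. c * (q * q ^ k)) + d * q ^ (2 * n + 1)"
    by (subst sum.lessThan_Suc, subst sum.lessThan_Suc_shift) (simp add: e_def)
  also have "(\<Sum>k<2 * n. c * (q * q ^ k)) = c * q * q_bracket (2 * n) q"
    by (simp add: q_bracket_def sum_distrib_left mult.assoc)
  finally show ?thesis .
qed

lemma char_sum:
  assumes "n \<le> N"
  shows "(\<Sum>\<pi>\<in>signed_perms n. \<chi> \<pi> * q ^ sor_B n \<pi>)
           = (\<Prod>k=1..n. 1 + c * q * q_bracket (2 * k - 2) q + d * q ^ (2 * k - 1))"
  using assms
proof (induction n)
  case 0
  show ?case unfolding signed_perms_0 by (simp add: char_id sor_B_0 flip: id_def)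
next
  case (Suc n)
  let ?s = "\<lambda>a. signed_swap a (int (Suc n))"
  have step: "\<chi> (\<rho> \<circ> ?s a) * q ^ sor_B (Suc n) (\<rho> \<circ> ?s a)
      = (\<chi> \<rho> * q ^ sor_B n \<rho>) * (\<chi> (?s a) * q ^ swap_weight (Suc n) a)"
    if "\<rho> \<in> signed_perms n" "a \<in> letters (Suc n)" for \<rho> a
  proof -
    have "\<rho> \<in> signed_perms N" "?s a \<in> signed_perms N"
      using that Suc.prems signed_perms_mono[of n N]
      by (auto intro!: signed_swap_in_signed_perms)
    then show ?thesis
      by (simp only: mult sor_B_Suc[OF that] power_add) (simp only: mult_ac)
  qed
  have "(\<Sum>\<pi>\<in>signed_perms (Suc n). \<chi> \<pi> * q ^ sor_B (Suc n) \<pi>)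
      = (\<Sum>(\<rho>, a)\<in>signed_perms n \<times> letters (Suc n).
           \<chi> (\<rho> \<circ> ?s a) * q ^ sor_B (Suc n) (\<rho> \<circ> ?s a))"
    by (subst sum.reindex_bij_betw[OF signed_perms_Suc_bij, symmetric])
       (simp only: case_prod_unfold)
  also have "\<dots> = (\<Sum>(\<rho>, a)\<in>signed_perms n \<times> letters (Suc n).
           (\<chi> \<rho> * q ^ sor_B n \<rho>) * (\<chi> (?s a) * q ^ swap_weight (Suc n) a))"
    by (intro sum.cong refl) (elim SigmaE, simp only: prod.case step)
  also have "\<dots> = (\<Sum>\<rho>\<in>signed_perms n. \<chi> \<rho> * q ^ sor_B n \<rho>) *
      (\<Sum>a\<in>letters (Suc n). \<chi> (?s a) * q ^ swap_weight (Suc n) a)"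
    by (simp only: sum_product sum.cartesian_product)
  also have "\<dots> = (\<Prod>k=1..Suc n. 1 + c * q * q_bracket (2 * k - 2) q + d * q ^ (2 * k - 1))"
    using Suc.prems by (subst char_coset_sum) (simp_all add: Suc.IH del: of_nat_Suc)
  finally show ?case .
qed

end

section \<open>The three characters\<close>

lemma minus_one_power_card:
  assumes "finite A"
  shows "(- 1 :: 'a::comm_ring_1) ^ card {x \<in> A. P x} = (\<Prod>x\<in>A. if P x then - 1 else 1)"
  using assms by (simp add: prod.If_cases Int_def conj_commute)

lemma abs_perm_bij:
  assumes "\<pi> \<in> signed_perms n"
  shows "bij_betw (abs_perm \<pi>) {1..n} {1..n}"
proof -
  note per = signed_perms_permutes[OF assms]
  have "inj_on (abs_perm \<pi>) {1..n}"
  proof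
    fix i j assume ij: "i \<in> {1..n}" "j \<in> {1..n}" "abs_perm \<pi> i = abs_perm \<pi> j"
    then have "\<pi> (int i) = \<pi> (int j) \<or> \<pi> (int i) = \<pi> (- int j)"
      unfolding abs_perm_def signed_perms_odd[OF assms] by linarith
    then have "int i = int j \<or> int i = - int j"
      by (simp add: inj_eq[OF permutes_inj[OF per]])
    then show "i = j" using ij by auto
  qed
  moreover have "abs_perm \<pi> ` {1..n} \<subseteq> {1..n}"
  proof safe
    fix i assume "i \<in> {1..n}"
    then have "\<pi> (int i) \<in> letters n" by (simp only: permutes_in_image[OF per]) auto
    then show "abs_perm \<pi> i \<in> {1..n}" by (auto simp: abs_perm_def)
  qed
  ultimately show ?thesis
    by (simp add: bij_betw_def endo_inj_surj)
qed

lemma abs_perm_comp: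
  assumes "\<pi> \<in> signed_perms n"
  shows "abs_perm (\<pi> \<circ> \<rho>) i = abs_perm \<pi> (abs_perm \<rho> i)"
  using signed_perms_odd[OF assms, of "\<rho> (int i)"]
  by (cases "\<rho> (int i) \<ge> 0") (simp_all add: abs_perm_def)

text \<open>
  The parity is the product of the signs of the entries. As \<open>\<pi>\<close> is odd, the sign of \<open>\<pi> (\<rho> i)\<close>
  is the sign of \<open>\<rho> i\<close> times that of the entry of \<open>\<pi>\<close> at the absolute value of \<open>\<rho> i\<close>, and
  these absolute values merely permute the positions.
\<close>
lemma neg_character:
  assumes "\<pi> \<in> signed_perms n" "\<rho> \<in> signed_perms n"
  shows "(- 1 :: 'a::comm_ring_1) ^ neg n (\<pi> \<circ> \<rho>) = (- 1) ^ neg n \<pi> * (- 1) ^ neg n \<rho>"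
proof -
  define s :: "(int \<Rightarrow> int) \<Rightarrow> nat \<Rightarrow> 'a" where "s p i = (if p (int i) < 0 then - 1 else 1)" for p i
  have eq: "(- 1 :: 'a) ^ neg n p = (\<Prod>i=1..n. s p i)" for p
    unfolding neg_def Neg_def s_def by (rule minus_one_power_card) simp
  have "s (\<pi> \<circ> \<rho>) i = s \<pi> (abs_perm \<rho> i) * s \<rho> i" if "i \<in> {1..n}" for i
  proof -
    have "\<rho> (int i) \<in> letters n" 
      using that by (simp only: permutes_in_image[OF signed_perms_permutes[OF assms(2)]]) auto
    then have "\<pi> (\<rho> (int i)) \<in> letters n"
      by (simp only: permutes_in_image[OF signed_perms_permutes[OF assms(1)]])
    then show ?thesis
      using signed_perms_odd[OF assms(1), of "\<rho> (int i)"]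
      by (auto simp: s_def abs_perm_def abs_if)
  qed
  then have "(\<Prod>i=1..n. s (\<pi> \<circ> \<rho>) i) = (\<Prod>i=1..n. s \<pi> (abs_perm \<rho> i)) * (\<Prod>i=1..n. s \<rho> i)"
    by (simp add: prod.distrib)
  also have "(\<Prod>i=1..n. s \<pi> (abs_perm \<rho> i)) = (\<Prod>i=1..n. s \<pi> i)"
    by (rule prod.reindex_bij_betw[OF abs_perm_bij[OF assms(2)]])
  finally show ?thesis by (simp only: eq)
qed

text \<open>
  The argument for \<open>neg_character\<close> with positions replaced by pairs of positions: whether \<open>u\<close>
  reverses the order of two numbers does not depend on the order in which they are listed, so this
  information is a function on two-element sets, which \<open>v\<close> permutes.
\<close>
lemma inversions_character:
  fixes u v :: "nat \<Rightarrow> nat"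
  assumes u: "bij_betw u {1..n} {1..n}" and v: "bij_betw v {1..n} {1..n}"
  shows "(- 1 :: 'a::comm_ring_1) ^ inversions n (u \<circ> v)
           = (- 1) ^ inversions n u * (- 1) ^ inversions n v"
proof -
  define S :: "(nat \<times> nat) set" where "S = {(i, j). 1 \<le> i \<and> i < j \<and> j \<le> n}"
  define s :: "nat \<Rightarrow> nat \<Rightarrow> 'a" where "s x y = (if x > y then - 1 else 1)" for x y
  \<comment> \<open>the action of \<open>v\<close> on two-element sets, each written as an increasing pair\<close>
  define h where "h = (\<lambda>(i, j). (min (v i) (v j), max (v i) (v j)))"
  have fin: "finite S"
    by (rule finite_subset[of _ "{1..n} \<times> {1..n}"]) (auto simp: S_def)
  have eq: "(- 1 :: 'a) ^ inversions n w = (\<Prod>(i, j)\<in>S. s (w i) (w j))" for w :: "nat \<Rightarrow> nat"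
  proof -
    have "{(i, j). 1 \<le> i \<and> i < j \<and> j \<le> n \<and> w i > w j} = {x \<in> S. w (fst x) > w (snd x)}"
      by (auto simp: S_def)
    then show ?thesis
      using minus_one_power_card[OF fin, of "\<lambda>x. w (fst x) > w (snd x)", where 'a = 'a]
      by (simp add: inversions_def s_def case_prod_unfold)
  qed
  have vin: "v i \<in> {1..n}" if "i \<in> {1..n}" for i using bij_betw_apply[OF v that] .
  have vinj: "v i = v j \<longleftrightarrow> i = j" if "i \<in> {1..n}" "j \<in> {1..n}" for i j
    by (rule inj_on_eq_iff[OF bij_betw_imp_inj_on[OF v] that])
  have uinj: "u i = u j \<longleftrightarrow> i = j" if "i \<in> {1..n}" "j \<in> {1..n}" for i j
    by (rule inj_on_eq_iff[OF bij_betw_imp_inj_on[OF u] that])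
  have "inj_on h S"
  proof
    fix x y assume xy: "x \<in> S" "y \<in> S" "h x = h y"
    obtain i j k l where e: "x = (i, j)" "y = (k, l)" by fastforce
    have "v i = v k \<and> v j = v l \<or> v i = v l \<and> v j = v k"
      using xy(3) by (auto simp: h_def e min_def max_def split: if_splits)
    then show "x = y" using xy(1,2) by (auto simp: e S_def vinj)
  qed
  moreover have "h ` S \<subseteq> S"
  proof (rule image_subsetI)
    fix x assume "x \<in> S"
    moreover obtain i j where "x = (i, j)" by fastforce
    ultimately have "i \<in> {1..n}" "j \<in> {1..n}" "i \<noteq> j" by (auto simp: S_def)
    with \<open>x = (i, j)\<close> vin[of i] vin[of j] vinj[of i j] show "h x \<in> S"
      by (auto simp: h_def S_def min_def max_def)
  qed
  ultimately have h: "bij_betw h S S" using fin by (simp add: bij_betw_def endo_inj_surj)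
  \<comment> \<open>whether \<open>u\<close> reverses the order of two numbers, a symmetric function of them\<close>
  define t where "t = (\<lambda>(a, b). s (u a) (u b) * s a b)"
  have "s (u (v i)) (u (v j)) = t (h (i, j)) * s (v i) (v j)" if "(i, j) \<in> S" for i j
  proof -
    have ij: "i \<in> {1..n}" "j \<in> {1..n}" "i \<noteq> j" using that by (auto simp: S_def)
    then have "v i \<noteq> v j" "u (v i) \<noteq> u (v j)" using vinj vin uinj by auto
    then show ?thesis by (auto simp: t_def h_def s_def min_def max_def)
  qed
  then have "(- 1 :: 'a) ^ inversions n (u \<circ> v) = (\<Prod>x\<in>S. t (h x) * (case x of (i, j) \<Rightarrow> s (v i) (v j)))"
    unfolding eq by (intro prod.cong) auto
  also have "\<dots> = (\<Prod>x\<in>S. t (h x)) * (- 1) ^ inversions n v"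
    by (simp add: prod.distrib eq)
  also have "(\<Prod>x\<in>S. t (h x)) = (\<Prod>x\<in>S. t x)"
    by (rule prod.reindex_bij_betw[OF h])
  also have "(\<Prod>x\<in>S. t x) = (- 1) ^ inversions n u"
    unfolding eq by (intro prod.cong) (auto simp: t_def s_def S_def)
  finally show ?thesis .
qed

lemma inversions_abs_perm_character:
  assumes "\<pi> \<in> signed_perms n" "\<rho> \<in> signed_perms n"
  shows "(- 1 :: 'a::comm_ring_1) ^ inversions n (abs_perm (\<pi> \<circ> \<rho>))
           = (- 1) ^ inversions n (abs_perm \<pi>) * (- 1) ^ inversions n (abs_perm \<rho>)"
proof -
  have "abs_perm (\<pi> \<circ> \<rho>) = abs_perm \<pi> \<circ> abs_perm \<rho>"
    using abs_perm_comp[OF assms(1)] by auto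
  then show ?thesis
    using inversions_character[OF abs_perm_bij abs_perm_bij, OF assms] by simp
qed

lemma neg_simple_0: "n \<ge> 1 \<Longrightarrow> neg n (signed_swap 1 (- 1)) = 1"
proof -
  assume "n \<ge> 1"
  then have "Neg n (signed_swap 1 (- 1)) = {1}"
    by (auto simp: Neg_def signed_swap_def split: if_splits)
  then show ?thesis by (simp add: neg_def)
qed

lemma neg_simple_i: "1 \<le> i \<Longrightarrow> neg n (signed_swap (int i) (int i + 1)) = 0"
  by (auto simp: neg_def Neg_def signed_swap_def)

lemma inversions_id: "inversions n (id :: nat \<Rightarrow> nat) = 0"
proof -
  have "{(i, j). 1 \<le> i \<and> i < j \<and> j \<le> n \<and> id i > (id j :: nat)} = {}" by auto
  then show ?thesis unfolding inversions_def by (simp only: card.empty)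
qed

lemma inversions_simple_0: "inversions n (abs_perm (signed_swap 1 (- 1))) = 0"
proof -
  have "abs_perm (signed_swap 1 (- 1)) = id"
    by (auto simp: abs_perm_def signed_swap_def)
  then show ?thesis by (simp only: inversions_id)
qed

lemma inversions_simple_i:
  assumes "1 \<le> i" "i < n"
  shows "inversions n (abs_perm (signed_swap (int i) (int i + 1))) = 1"
proof -
  have "abs_perm (signed_swap (int i) (int i + 1)) k
      = (if k = i then Suc i else if k = Suc i then i else k)" for k
    using assms by (auto simp: abs_perm_def signed_swap_def)
  then have "{(k, l). 1 \<le> k \<and> k < l \<and> l \<le> n \<and>
      abs_perm (signed_swap (int i) (int i + 1)) k > abs_perm (signed_swap (int i) (int i + 1)) l}
      = {(i, Suc i)}"
    using assms by (auto split: if_splits)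
  then show ?thesis by (simp add: inversions_def)
qed

text \<open>
  Needed to know that the minimum defining \<open>length_B\<close> is attained: the coset
  decomposition reduces it to reflections, which are conjugates of generators by words.
\<close>
lemma generators_B_generate:
  assumes "\<pi> \<in> signed_perms n"
  shows "\<exists>ws. set ws \<subseteq> generators_B n \<and> foldr (\<circ>) ws id = \<pi>"
proof -
  define G where "G = {foldr (\<circ>) ws id | ws. set ws \<subseteq> generators_B n}"
  have comp: "p \<circ> r \<in> G" if pr: "p \<in> G" "r \<in> G" for p r
  proof -
    obtain ws vs where "set (ws @ vs) \<subseteq> generators_B n"
      and "p = foldr (\<circ>) ws id" "r = foldr (\<circ>) vs id"
      using pr by (auto simp: G_def)
    then show ?thesis unfolding G_def by (intro CollectI exI[of _ "ws @ vs"] conjI)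
        (simp_all only: foldr_comp_append)
  qed
  have gen: "g \<in> G" if "g \<in> generators_B n" for g
    unfolding G_def using that by (intro CollectI exI[of _ "[g]"]) auto
  have refl: "signed_swap a (int m) \<in> G" if a: "a \<in> letters m" and m: "m \<le> n" for a m
  proof -
    consider "a = int m" | "a = - int m" "m \<ge> 1" | "\<bar>a\<bar> < int m" "a \<noteq> 0"
      using a by force
    then show ?thesis
    proof cases
      case 1
      have "id \<in> G" unfolding G_def by (intro CollectI exI[of _ "[]"]) auto
      then show ?thesis using 1 by (simp add: signed_swap_self)
    next
      case 2
      show ?thesis unfolding 2(1)
        by (rule short_reflection_induct[of m n])
           (use 2 m in \<open>blast intro: comp gen simple_in_generators_B\<close>)+
    next
      case 3
      show ?thesis
        by (rule long_reflection_induct[of a m n])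
           (use 3 m in \<open>blast intro: comp gen simple_in_generators_B\<close>)+
    qed
  qed
  have "signed_perms m \<subseteq> G" if "m \<le> n" for m
    using that
  proof (induction m)
    case 0
    have "id \<in> G" unfolding G_def by (intro CollectI exI[of _ "[]"]) auto
    then show ?case by (simp add: signed_perms_0)
  next
    case (Suc m)
    show ?case
    proof
      fix p assume "p \<in> signed_perms (Suc m)"
      then obtain \<rho> a where "\<rho> \<in> signed_perms m" "a \<in> letters (Suc m)"
        "p = \<rho> \<circ> signed_swap a (int (Suc m))"
        by (rule signed_perms_Suc_cases)
      moreover from this Suc have "\<rho> \<in> G" by auto
      ultimately show "p \<in> G" using comp[of \<rho>] refl[of a "Suc m"] Suc.prems by metis
    qed
  qed
  with assms show ?thesis by (auto simp: G_def)
qed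

text \<open>
  Any word in the generators has the parity of its length determined by its product, because the
  product of the two characters is $-1$ on every generator; a shortest word is one of them.
\<close>
lemma length_B_parity:
  assumes "n \<ge> 1" "\<pi> \<in> signed_perms n"
  shows "(- 1 :: 'a::comm_ring_1) ^ length_B n \<pi>
           = (- 1) ^ neg n \<pi> * (- 1) ^ inversions n (abs_perm \<pi>)"
proof -
  define \<chi> :: "(int \<Rightarrow> int) \<Rightarrow> 'a"
    where "\<chi> p = (- 1) ^ neg n p * (- 1) ^ inversions n (abs_perm p)" for p
  have \<chi>_mult: "\<chi> (p \<circ> r) = \<chi> p * \<chi> r" if "p \<in> signed_perms n" "r \<in> signed_perms n" for p r
    using that by (simp add: \<chi>_def neg_character inversions_abs_perm_character mult_ac)
  have \<chi>_id: "\<chi> id = 1"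
  proof -
    have "abs_perm id = id" "neg n id = 0" by (auto simp: abs_perm_def neg_def Neg_def)
    then show ?thesis by (simp only: \<chi>_def inversions_id) simp
  qed
  have \<chi>_gen: "\<chi> g = - 1" if "g \<in> generators_B n" for g
    using that assms(1)
    by (elim generators_B_cases)
       (auto simp: \<chi>_def neg_simple_0 neg_simple_i inversions_simple_0 inversions_simple_i)
  have word: "foldr (\<circ>) ws id \<in> signed_perms n \<and> \<chi> (foldr (\<circ>) ws id) = (- 1) ^ length ws"
    if "set ws \<subseteq> generators_B n" for ws
    using that
  proof (induction ws)
    case Nil
    show ?case using \<chi>_id id_in_signed_perms by (simp flip: id_def)
  next
    case (Cons g ws)
    have "g \<in> generators_B n" using Cons.prems by simp
    then have g: "g \<in> signed_perms n" "\<chi> g = - 1"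
      using generators_B_subset[OF assms(1)] \<chi>_gen by blast+
    have "set ws \<subseteq> generators_B n" using Cons.prems by simp
    from Cons.IH[OF this] have
      ws: "foldr (\<circ>) ws id \<in> signed_perms n" "\<chi> (foldr (\<circ>) ws id) = (- 1) ^ length ws"
      by blast+
    have "foldr (\<circ>) (g # ws) id = g \<circ> foldr (\<circ>) ws id" by (simp only: foldr.simps comp_apply)
    then show ?case
      using signed_perms_comp[OF g(1) ws(1)] \<chi>_mult[OF g(1) ws(1)] by (simp only: g ws length_Cons power_Suc)
  qed
  have "\<exists>ws. length ws = length_B n \<pi> \<and> set ws \<subseteq> generators_B n \<and> foldr (\<circ>) ws id = \<pi>"
    unfolding length_B_def
    by (rule LeastI_ex) (use generators_B_generate[OF assms(2)] in blast)
  then show ?thesis using word by (fold \<chi>_def) metis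
qed

theorem corollary3p2:
  fixes n :: nat and q :: "'a::comm_ring_1"
  assumes "n \<ge> 1"
  shows "(\<Sum>\<pi>\<in>signed_perms n. (- 1) ^ length_B n \<pi> * q ^ sor_B n \<pi>)
           = (\<Prod>k=1..n. 1 - q * q_bracket (2 * k - 1) q) \<and>
         (\<Sum>\<pi>\<in>signed_perms n. (- 1) ^ neg n \<pi> * q ^ sor_B n \<pi>)
           = (\<Prod>k=1..n. q_bracket (2 * k - 1) q - q ^ (2 * k - 1)) \<and>
         (\<Sum>\<pi>\<in>signed_perms n. (- 1) ^ inversions n (abs_perm \<pi>) * q ^ sor_B n \<pi>)
           = (\<Prod>k=1..n. 1 - q * q_bracket (2 * k - 2) q + q ^ (2 * k - 1))"
proof (intro conjI)
  have last: "q_bracket (2 * k - 1) q = q_bracket (2 * k - 2) q + q ^ (2 * k - 2)"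
    and first: "q_bracket (2 * k - 1) q = 1 + q * q_bracket (2 * k - 2) q"
    and pow: "q ^ (2 * k - 1) = q * q ^ (2 * k - 2)" if k: "k \<in> {1..n}" for k
  proof -
    obtain m where "k = Suc m" using k by (cases k) auto
    then show "q_bracket (2 * k - 1) q = q_bracket (2 * k - 2) q + q ^ (2 * k - 2)"
      "q_bracket (2 * k - 1) q = 1 + q * q_bracket (2 * k - 2) q"
      "q ^ (2 * k - 1) = q * q ^ (2 * k - 2)"
      by (simp_all only: q_bracket_def sum.lessThan_Suc_shift sum_distrib_left)
         (simp_all add: sum.lessThan_Suc_shift sum_distrib_left flip: sum.lessThan_Suc)
  qed
  \<comment> \<open>the parity of the length is handled as the product of the other two characters\<close>
  interpret neg: signed_character n "\<lambda>\<pi>. (- 1 :: 'a) ^ neg n \<pi>" 1 "- 1"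
    by unfold_locales (use assms in \<open>auto simp: neg_character neg_simple_0 neg_simple_i\<close>)
  interpret inv: signed_character n "\<lambda>\<pi>. (- 1 :: 'a) ^ inversions n (abs_perm \<pi>)" "- 1" 1
    by unfold_locales
       (use assms in \<open>auto simp: inversions_abs_perm_character inversions_simple_0 inversions_simple_i\<close>)
  interpret len: signed_character n
    "\<lambda>\<pi>. (- 1 :: 'a) ^ neg n \<pi> * (- 1) ^ inversions n (abs_perm \<pi>)" "- 1" "- 1"
    by unfold_locales
       (use assms in \<open>auto simp: neg.mult inv.mult neg_simple_0 neg_simple_i
          inversions_simple_0 inversions_simple_i mult_ac\<close>)
  have "(\<Sum>\<pi>\<in>signed_perms n. (- 1) ^ length_B n \<pi> * q ^ sor_B n \<pi>)
      = (\<Sum>\<pi>\<in>signed_perms n. (- 1) ^ neg n \<pi> * (- 1) ^ inversions n (abs_perm \<pi>) * q ^ sor_B n \<pi>)"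
    using assms by (simp add: length_B_parity)
  also have "\<dots> = (\<Prod>k=1..n. 1 - q * q_bracket (2 * k - 1) q)"
    unfolding len.char_sum[OF order_refl]
    by (intro prod.cong refl) (simp only: last pow, simp add: algebra_simps)
  finally show "(\<Sum>\<pi>\<in>signed_perms n. (- 1) ^ length_B n \<pi> * q ^ sor_B n \<pi>)
      = (\<Prod>k=1..n. 1 - q * q_bracket (2 * k - 1) q)" .
  show "(\<Sum>\<pi>\<in>signed_perms n. (- 1) ^ neg n \<pi> * q ^ sor_B n \<pi>)
      = (\<Prod>k=1..n. q_bracket (2 * k - 1) q - q ^ (2 * k - 1))"
    unfolding neg.char_sum[OF order_refl]
    by (intro prod.cong refl) (simp only: first, simp)
  show "(\<Sum>\<pi>\<in>signed_perms n. (- 1) ^ inversions n (abs_perm \<pi>) * q ^ sor_B n \<pi>)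
      = (\<Prod>k=1..n. 1 - q * q_bracket (2 * k - 2) q + q ^ (2 * k - 1))"
    unfolding inv.char_sum[OF order_refl]
    by (intro prod.cong refl) simp
qed

end
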